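(* For every dcpo $P$, the following are equivalent. (1) $P$ contains a chain order-isomorphic to $\mathbb{Q}$. (2) $P$ contains a sub-dcpo Scott-isomorphic to $[0,1]$. (3) $[0,1]$ is a Scott-continuous retract of $P$.
   Context: $[0,1]$ and $\mathbb{Q}$ carry their usual orders. A dcpo is a poset in which every nonempty directed subset has a supremum. A sub-dcpo of $P$ is a subset closed under suprema (taken in $P$) of its nonempty directed subsets, with the inherited order. A map between dcpos is Scott-continuous if it is monotone and preserves suprema of directed sets; two dcpos are Scott-isomorphic if there is a bijection between them that is Scott-continuous in both directions (equivalently, an order isomorphism). $[0,1]$ is a Scott-continuous retract of $P$ if there are Scott-continuous maps $\rho:P\to[0,1]$ and $e:[0,1]\to P$ with $\rho\circ e=\mathrm{id}_{[0,1]}$. *)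

theory Defs
  imports Complex_Main
begin

text \<open>
  A poset is a carrier set \<open>P\<close> together with a relation \<open>le\<close>, of which only the restriction
  to \<open>P\<close> matters. Thus the carrier may be empty, and a subset of \<open>P\<close> with the inherited order
  is given by the same relation.
\<close>

definition poset_on :: "'a set \<Rightarrow> ('a \<Rightarrow> 'a \<Rightarrow> bool) \<Rightarrow> bool" where
  "poset_on P le \<longleftrightarrow> reflp_on P le \<and> antisymp_on P le \<and> transp_on P le"

text \<open>Directed sets are nonempty throughout; a dcpo need not have a least element.\<close>

definition directed_in :: "'a set \<Rightarrow> ('a \<Rightarrow> 'a \<Rightarrow> bool) \<Rightarrow> 'a set \<Rightarrow> bool" where
  "directed_in P le D \<longleftrightarrow>
     D \<subseteq> P \<and> D \<noteq> {} \<and> (\<forall>x\<in>D. \<forall>y\<in>D. \<exists>z\<in>D. le x z \<and> le y z)"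

definition is_sup_in :: "'a set \<Rightarrow> ('a \<Rightarrow> 'a \<Rightarrow> bool) \<Rightarrow> 'a set \<Rightarrow> 'a \<Rightarrow> bool" where
  "is_sup_in P le D s \<longleftrightarrow>
     s \<in> P \<and> (\<forall>x\<in>D. le x s) \<and> (\<forall>u\<in>P. (\<forall>x\<in>D. le x u) \<longrightarrow> le s u)"

definition dcpo_on :: "'a set \<Rightarrow> ('a \<Rightarrow> 'a \<Rightarrow> bool) \<Rightarrow> bool" where
  "dcpo_on P le \<longleftrightarrow>
     poset_on P le \<and> (\<forall>D. directed_in P le D \<longrightarrow> (\<exists>s. is_sup_in P le D s))"

text \<open>The supremum in the next definition is taken in \<open>P\<close>, not in \<open>S\<close>.\<close>

definition sub_dcpo :: "'a set \<Rightarrow> 'a set \<Rightarrow> ('a \<Rightarrow> 'a \<Rightarrow> bool) \<Rightarrow> bool" where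
  "sub_dcpo S P le \<longleftrightarrow>
     S \<subseteq> P \<and> (\<forall>D s. directed_in S le D \<and> is_sup_in P le D s \<longrightarrow> s \<in> S)"

definition scott_continuous ::
  "'a set \<Rightarrow> ('a \<Rightarrow> 'a \<Rightarrow> bool) \<Rightarrow> 'b set \<Rightarrow> ('b \<Rightarrow> 'b \<Rightarrow> bool) \<Rightarrow> ('a \<Rightarrow> 'b) \<Rightarrow> bool"
where
  "scott_continuous P leP Q leQ f \<longleftrightarrow>
     f ` P \<subseteq> Q \<and> monotone_on P leP leQ f \<and>
     (\<forall>D s. directed_in P leP D \<and> is_sup_in P leP D s \<longrightarrow> is_sup_in Q leQ (f ` D) (f s))"

definition scott_isomorphic ::
  "'a set \<Rightarrow> ('a \<Rightarrow> 'a \<Rightarrow> bool) \<Rightarrow> 'b set \<Rightarrow> ('b \<Rightarrow> 'b \<Rightarrow> bool) \<Rightarrow> bool"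
where
  "scott_isomorphic P leP Q leQ \<longleftrightarrow>
     (\<exists>f. bij_betw f P Q \<and> scott_continuous P leP Q leQ f \<and>
          scott_continuous Q leQ P leP (inv_into P f))"

definition order_isomorphic ::
  "'a set \<Rightarrow> ('a \<Rightarrow> 'a \<Rightarrow> bool) \<Rightarrow> 'b set \<Rightarrow> ('b \<Rightarrow> 'b \<Rightarrow> bool) \<Rightarrow> bool"
where
  "order_isomorphic P leP Q leQ \<longleftrightarrow>
     (\<exists>f. bij_betw f P Q \<and> (\<forall>x\<in>P. \<forall>y\<in>P. leP x y \<longleftrightarrow> leQ (f x) (f y)))"

definition scott_retract ::
  "'b set \<Rightarrow> ('b \<Rightarrow> 'b \<Rightarrow> bool) \<Rightarrow> 'a set \<Rightarrow> ('a \<Rightarrow> 'a \<Rightarrow> bool) \<Rightarrow> bool"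
where
  "scott_retract Q leQ P leP \<longleftrightarrow>
     (\<exists>r e. scott_continuous P leP Q leQ r \<and> scott_continuous Q leQ P leP e \<and>
            (\<forall>t\<in>Q. r (e t) = t))"

end

(*
  All three conditions are equivalent to the existence of a Scott-continuous order embedding
  e : [0,1] -> P. Out of a copy q of the rationals one obtains e t as the supremum of the q r
  with r < t; two rationals between s and t show that e is strict. Given e, the principal ideals
  of the e t are Scott-closed, so x |-> inf {t. x <= e t} (with value 1 if there is no such t)
  is Scott-continuous, and it is a left inverse of e.
*)
theory Submission
  imports Defs
begin

section \<open>Suprema, directed sets and order isomorphisms\<close>

lemma is_sup_in_unique:
  assumes "antisymp_on P le" "is_sup_in P le D s" "is_sup_in P le D s'"
  shows "s = s'"
  using assms unfolding is_sup_in_def by (blast dest: antisymp_onD)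

lemma is_sup_in_subset:
  assumes "is_sup_in P le D s" "S \<subseteq> P" "s \<in> S"
  shows "is_sup_in S le D s"
  using assms unfolding is_sup_in_def by blast

lemma directed_in_subset:
  assumes "directed_in S le D" "S \<subseteq> P"
  shows "directed_in P le D"
  using assms unfolding directed_in_def by blast

lemma directed_in_image:
  assumes "directed_in P leP D" "monotone_on P leP leQ f" "f ` P \<subseteq> Q"
  shows "directed_in Q leQ (f ` D)"
  unfolding directed_in_def
proof (intro conjI ballI)
  show "f ` D \<subseteq> Q" "f ` D \<noteq> {}"
    using assms unfolding directed_in_def by auto
next
  fix x y assume "x \<in> f ` D" "y \<in> f ` D"
  then obtain a b where ab: "a \<in> D" "x = f a" "b \<in> D" "y = f b"
    by blast
  then obtain c where c: "c \<in> D" "leP a c" "leP b c"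
    using assms(1) unfolding directed_in_def by blast
  have "D \<subseteq> P"
    using assms(1) unfolding directed_in_def by blast
  then have "leQ x (f c)" "leQ y (f c)"
    using ab c monotone_onD[OF assms(2)] by blast+
  then show "\<exists>z\<in>f ` D. leQ x z \<and> leQ y z"
    using c(1) by blast
qed

text \<open>A member of \<open>D\<close> keeps \<open>Sup D\<close> above 0, and the bound 1 keeps
  it below 1. The real supremum thus lies in the interval and is the supremum there; uniqueness of
  suprema gives the other direction.\<close>

lemma is_sup_in_unit_interval_iff:
  fixes D :: "real set"
  assumes "D \<subseteq> {0..1}" "D \<noteq> {}"
  shows "is_sup_in {0..1} (\<le>) D s \<longleftrightarrow> s = Sup D"
proof -
  have bdd: "bdd_above D"
    using assms(1) by (auto intro!: bdd_aboveI[where M = 1])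
  obtain d where d: "d \<in> D" "0 \<le> d"
    using assms by fastforce
  have "0 \<le> Sup D"
    using d bdd by (meson cSup_upper order_trans)
  moreover have "Sup D \<le> 1"
    using assms by (auto intro!: cSup_least)
  ultimately have sup: "is_sup_in {0..1} (\<le>) D (Sup D)"
    using assms bdd unfolding is_sup_in_def by (auto intro: cSup_upper cSup_least)
  then show ?thesis
    using is_sup_in_unique[of "{0..1}" "(\<le>)" D s "Sup D"] by auto
qed

lemma scott_continuous_order_iso:
  assumes bij: "bij_betw f P Q"
    and le: "\<And>x y. x \<in> P \<Longrightarrow> y \<in> P \<Longrightarrow> leP x y \<longleftrightarrow> leQ (f x) (f y)"
  shows "scott_continuous P leP Q leQ f"
  unfolding scott_continuous_def
proof (intro conjI allI impI)
  show im: "f ` P \<subseteq> Q"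
    using bij by (simp add: bij_betw_def)
  show "monotone_on P leP leQ f"
    using le by (simp add: monotone_on_def)
  fix D s assume D: "directed_in P leP D \<and> is_sup_in P leP D s"
  then have DP: "D \<subseteq> P" and s: "s \<in> P"
    unfolding directed_in_def is_sup_in_def by auto
  show "is_sup_in Q leQ (f ` D) (f s)"
    unfolding is_sup_in_def
  proof (intro conjI ballI impI)
    show "f s \<in> Q"
      using im s by blast
    show "leQ x (f s)" if "x \<in> f ` D" for x
      using that D DP s le unfolding is_sup_in_def by blast
    show "leQ (f s) u" if u: "u \<in> Q" "\<forall>x\<in>f ` D. leQ x u" for u
    proof -
      obtain v where v: "v \<in> P" "u = f v"
        using u(1) bij by (auto simp: bij_betw_def)
      then have "leP x v" if "x \<in> D" for x
        using that u(2) DP le by blast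
      then show ?thesis
        using D v s le unfolding is_sup_in_def by blast
    qed
  qed
qed

lemma scott_isomorphicI:
  assumes bij: "bij_betw f P Q"
    and le: "\<And>x y. x \<in> P \<Longrightarrow> y \<in> P \<Longrightarrow> leP x y \<longleftrightarrow> leQ (f x) (f y)"
  shows "scott_isomorphic P leP Q leQ"
proof -
  have "scott_continuous Q leQ P leP (inv_into P f)"
  proof (rule scott_continuous_order_iso)
    show "bij_betw (inv_into P f) Q P"
      using bij by (rule bij_betw_inv_into)
    show "leQ x y \<longleftrightarrow> leP (inv_into P f x) (inv_into P f y)" if "x \<in> Q" "y \<in> Q" for x y
    proof -
      have "inv_into P f x \<in> P" "inv_into P f y \<in> P"
        using that bij by (auto simp: bij_betw_def inv_into_into)
      then have "leP (inv_into P f x) (inv_into P f y) \<longleftrightarrow>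
          leQ (f (inv_into P f x)) (f (inv_into P f y))"
        by (rule le)
      then show ?thesis
        using that bij by (simp add: bij_betw_inv_into_right)
    qed
  qed
  moreover have "scott_continuous P leP Q leQ f"
    using assms by (rule scott_continuous_order_iso)
  ultimately show ?thesis
    using bij unfolding scott_isomorphic_def by blast
qed

section \<open>Scott-continuous order embeddings\<close>

definition scott_embedding ::
  "'b set \<Rightarrow> ('b \<Rightarrow> 'b \<Rightarrow> bool) \<Rightarrow> 'a set \<Rightarrow> ('a \<Rightarrow> 'a \<Rightarrow> bool) \<Rightarrow> ('b \<Rightarrow> 'a) \<Rightarrow> bool"
where
  "scott_embedding Q leQ P leP e \<longleftrightarrow>
     scott_continuous Q leQ P leP e \<and> (\<forall>s\<in>Q. \<forall>t\<in>Q. leP (e s) (e t) \<longleftrightarrow> leQ s t)"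

text \<open>By reflexivity in \<open>P\<close>, equal values lie below each other both ways;
  reflection of the order and antisymmetry in \<open>Q\<close> then identify the arguments.\<close>

lemma scott_embedding_inj_on:
  assumes "scott_embedding Q leQ P leP e" "poset_on Q leQ" "poset_on P leP"
  shows "inj_on e Q"
proof (rule inj_onI)
  fix s t assume st: "s \<in> Q" "t \<in> Q" "e s = e t"
  then have "e s \<in> P"
    using assms(1) unfolding scott_embedding_def scott_continuous_def by blast
  then have "leP (e s) (e t)" "leP (e t) (e s)"
    using st(3) assms(3) unfolding poset_on_def by (auto dest: reflp_onD)
  then show "s = t"
    using st assms(1,2) unfolding scott_embedding_def poset_on_def by (blast dest: antisymp_onD)
qed

lemma poset_on_order: "poset_on A ((\<le>) :: 'a::order \<Rightarrow> 'a \<Rightarrow> bool)"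
  unfolding poset_on_def by (auto intro: reflp_onI antisymp_onI transp_onI)

section \<open>From a chain of rationals to an embedding of [0,1]\<close>

lemma rat_chain_imp_embedding:
  fixes le :: "'a \<Rightarrow> 'a \<Rightarrow> bool" and q :: "rat \<Rightarrow> 'a"
  assumes dcpo: "dcpo_on P le" and im: "range q \<subseteq> P"
    and q: "\<And>x y. le (q x) (q y) \<longleftrightarrow> x \<le> y"
  shows "\<exists>e. scott_embedding {0..1::real} (\<le>) P le e"
proof -
  have trans: "transp_on P le"
    using dcpo unfolding dcpo_on_def poset_on_def by blast
  \<comment> \<open>The cut is strict so that a rational below \<open>Sup D\<close> is already below
    some member of \<open>D\<close>, which yields continuity of \<open>e\<close>. The negative
    rationals keep \<open>L 0\<close> nonempty, as directedness demands.\<close>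
  define L where "L t = q ` {r. of_rat r < t}" for t :: real
  define e where "e t = (SOME s. is_sup_in P le (L t) s)" for t
  have dir: "directed_in P le (L t)" for t
    unfolding directed_in_def
  proof (intro conjI ballI)
    show "L t \<subseteq> P"
      using im by (auto simp: L_def)
    obtain r where "of_rat r < t"
      using of_rat_dense[of "t - 1" t] by auto
    then show "L t \<noteq> {}"
      by (auto simp: L_def)
    fix x y assume "x \<in> L t" "y \<in> L t"
    then obtain a b where ab: "of_rat a < t" "x = q a" "of_rat b < t" "y = q b"
      by (auto simp: L_def)
    then have "q (max a b) \<in> L t"
      by (auto simp: L_def max_def)
    moreover have "le x (q (max a b))" "le y (q (max a b))"
      by (simp_all add: ab q)
    ultimately show "\<exists>z\<in>L t. le x z \<and> le y z"
      by blast
  qed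
  have sup: "is_sup_in P le (L t) (e t)" for t
    using dcpo dir[of t] unfolding dcpo_on_def e_def by (metis someI_ex)
  have eP: "e t \<in> P" for t
    using sup unfolding is_sup_in_def by blast
  have qe: "le (q r) (e t)" if "of_rat r < t" for r t
    using sup[of t] that unfolding is_sup_in_def L_def by blast
  have e_least: "le (e t) u" if "u \<in> P" "\<And>r. of_rat r < t \<Longrightarrow> le (q r) u" for t u
    using sup[of t] that unfolding is_sup_in_def L_def by blast
  have e_mono: "le (e s) (e t)" if "s \<le> t" for s t
    using that by (intro e_least eP qe) auto
  have e_iff: "le (e s) (e t) \<longleftrightarrow> s \<le> t" for s t
  proof
    assume st: "le (e s) (e t)"
    show "s \<le> t"
    proof (rule ccontr)
      assume "\<not> s \<le> t"
      \<comment> \<open>\<open>q r\<close> bounds \<open>L t\<close>, so \<open>e t\<close> lies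
        below \<open>q r\<close>; and \<open>q r'\<close> lies below \<open>e s\<close>, hence below
        \<open>e t\<close> and below \<open>q r\<close>, against r < r'. The rational r alone would
        only give \<open>q r\<close> equal to both \<open>e s\<close> and \<open>e t\<close>, which
        is no contradiction.\<close>
      then obtain r where r: "t < of_rat r" "of_rat r < s"
        using of_rat_dense[of t s] by auto
      then obtain r' where r': "of_rat r < (of_rat r' :: real)" "of_rat r' < s"
        using of_rat_dense[of "of_rat r" s] by auto
      have "le (e t) (q r)"
      proof (rule e_least)
        show "q r \<in> P"
          using im by blast
        show "le (q x) (q r)" if "of_rat x < t" for x
        proof -
          have "(of_rat x :: real) < of_rat r"
            using that r(1) by linarith
          then show ?thesis
            by (simp add: q of_rat_less)
        qed
      qed
      moreover have "le (q r') (e s)"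
        using r'(2) by (rule qe)
      moreover have "q r \<in> P" "q r' \<in> P"
        using im by auto
      ultimately have "le (q r') (q r)"
        using st eP trans by (meson transp_onD)
      then show False
        using r'(1) by (simp add: q of_rat_less)
    qed
  qed (rule e_mono)
  have "scott_continuous {0..1} (\<le>) P le e"
    unfolding scott_continuous_def
  proof (intro conjI allI impI)
    show "e ` {0..1} \<subseteq> P"
      using eP by blast
    show "monotone_on {0..1} (\<le>) le e"
      using e_mono by (simp add: monotone_on_def)
    fix D and s :: real
    assume D: "directed_in {0..1} (\<le>) D \<and> is_sup_in {0..1} (\<le>) D s"
    then have D': "D \<subseteq> {0..1}" "D \<noteq> {}"
      unfolding directed_in_def by auto
    then have s: "s = Sup D"
      using D is_sup_in_unit_interval_iff by blast
    have ub: "x \<le> s" if "x \<in> D" for x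
      using D that unfolding is_sup_in_def by blast
    show "is_sup_in P le (e ` D) (e s)"
      unfolding is_sup_in_def
    proof (intro conjI ballI impI eP)
      show "le x (e s)" if "x \<in> e ` D" for x
        using that ub e_mono by blast
      show "le (e s) u" if u: "u \<in> P" "\<forall>x\<in>e ` D. le x u" for u
      proof (rule e_least[OF u(1)])
        fix r assume "of_rat r < s"
        \<comment> \<open>Here the strict cut pays off: r < \<open>Sup D\<close> gives a member x of
          \<open>D\<close> above r, and \<open>q r\<close> reaches u through
          \<open>e x\<close>.\<close>
        then obtain x where x: "x \<in> D" "of_rat r < x"
          unfolding s using D'(2) less_cSupD by blast
        then have "le (q r) (e x)" "le (e x) u"
          using u(2) qe by auto
        then show "le (q r) u"
          using u(1) eP im trans by (meson range_subsetD transp_onD)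
      qed
    qed
  qed
  then show ?thesis
    using e_iff unfolding scott_embedding_def by blast
qed

section \<open>Embeddings and sub-dcpos\<close>

lemma embedding_imp_sub_dcpo:
  fixes le :: "'a \<Rightarrow> 'a \<Rightarrow> bool"
  assumes po: "poset_on P le" and e: "scott_embedding {0..1::real} (\<le>) P le e"
  shows "sub_dcpo (e ` {0..1}) P le" "scott_isomorphic (e ` {0..1}) le {0..1::real} (\<le>)"
proof -
  have cont: "scott_continuous {0..1} (\<le>) P le e"
    and e_iff: "\<And>s t. s \<in> {0..1} \<Longrightarrow> t \<in> {0..1} \<Longrightarrow> le (e s) (e t) \<longleftrightarrow> s \<le> t"
    using e unfolding scott_embedding_def by auto
  have bij: "bij_betw e {0..1} (e ` {0..1})"
    using scott_embedding_inj_on[OF e poset_on_order po] by (rule inj_on_imp_bij_betw)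
  show "scott_isomorphic (e ` {0..1}) le {0..1::real} (\<le>)"
  proof (rule scott_isomorphicI[OF bij_betw_inv_into[OF bij]])
    fix x y assume "x \<in> e ` {0..1}" "y \<in> e ` {0..1}"
    then show "le x y \<longleftrightarrow> inv_into {0..1} e x \<le> inv_into {0..1} e y"
      using e_iff by (metis f_inv_into_f inv_into_into)
  qed
  show "sub_dcpo (e ` {0..1}) P le"
    unfolding sub_dcpo_def
  proof (intro conjI allI impI)
    show "e ` {0..1} \<subseteq> P"
      using cont unfolding scott_continuous_def by blast
    fix D s assume D: "directed_in (e ` {0..1}) le D \<and> is_sup_in P le D s"
    \<comment> \<open>Pulling \<open>D\<close> back to [0,1] gives a set that is directed because
      \<open>e\<close> reflects the order. Its supremum exists in [0,1], and continuity of
      \<open>e\<close> carries it to the supremum of \<open>D\<close> in \<open>P\<close>, which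
      therefore lies in the image.\<close>
    define T where "T = {t\<in>{0..1}. e t \<in> D}"
    have eT: "D = e ` T"
      using D unfolding directed_in_def T_def by auto
    have T: "directed_in {0..1} (\<le>) T"
      unfolding directed_in_def
    proof (intro conjI ballI)
      show "T \<subseteq> {0..1}"
        by (auto simp: T_def)
      show "T \<noteq> {}"
        using D eT unfolding directed_in_def by auto
      fix x y assume xy: "x \<in> T" "y \<in> T"
      then obtain z where "z \<in> T" "le (e x) (e z)" "le (e y) (e z)"
        using D unfolding directed_in_def eT by blast
      then show "\<exists>z\<in>T. x \<le> z \<and> y \<le> z"
        using xy e_iff unfolding T_def by blast
    qed
    have sup: "is_sup_in {0..1} (\<le>) T (Sup T)"
      using T is_sup_in_unit_interval_iff unfolding directed_in_def by blast
    then have "is_sup_in P le D (e (Sup T))"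
      using T cont unfolding scott_continuous_def eT by blast
    then have "s = e (Sup T)"
      using D po is_sup_in_unique unfolding poset_on_def by metis
    then show "s \<in> e ` {0..1}"
      using sup unfolding is_sup_in_def by blast
  qed
qed

text \<open>The inverse isomorphism preserves suprema as computed in \<open>S\<close>, whereas an
  embedding must preserve those computed in \<open>P\<close>. Closure of \<open>S\<close> under
  directed suprema of \<open>P\<close> makes the two agree.\<close>

lemma sub_dcpo_imp_embedding:
  assumes dcpo: "dcpo_on P leP" and sub: "sub_dcpo S P leP"
    and iso: "scott_isomorphic S leP Q leQ"
  shows "\<exists>e. scott_embedding Q leQ P leP e"
proof -
  obtain f where bij: "bij_betw f S Q" and f: "scott_continuous S leP Q leQ f"
    and g: "scott_continuous Q leQ S leP (inv_into S f)"
    using iso unfolding scott_isomorphic_def by blast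
  define e where "e = inv_into S f"
  have SP: "S \<subseteq> P"
    using sub unfolding sub_dcpo_def by blast
  have anti: "antisymp_on S leP"
    using dcpo SP antisymp_on_subset unfolding dcpo_on_def poset_on_def by blast
  have e_S: "e ` Q \<subseteq> S" and e_mono: "monotone_on Q leQ leP e"
    using g unfolding scott_continuous_def e_def by auto
  have fe: "f (e t) = t" if "t \<in> Q" for t
    using that bij unfolding e_def by (simp add: bij_betw_inv_into_right)
  \<comment> \<open>Order reflection: applying the monotone map \<open>f\<close> to
    \<open>leP (e s) (e t)\<close> and cancelling with \<open>fe\<close> gives
    \<open>leQ s t\<close>.\<close>
  have e_iff: "leP (e s) (e t) \<longleftrightarrow> leQ s t" if "s \<in> Q" "t \<in> Q" for s t
    using that e_S fe e_mono f unfolding scott_continuous_def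
    by (metis image_subset_iff monotone_onD)
  have "scott_continuous Q leQ P leP e"
    unfolding scott_continuous_def
  proof (intro conjI allI impI e_mono)
    show "e ` Q \<subseteq> P"
      using e_S SP by blast
    fix D s assume D: "directed_in Q leQ D \<and> is_sup_in Q leQ D s"
    then have dir: "directed_in S leP (e ` D)"
      using directed_in_image e_mono e_S by blast
    \<comment> \<open>The supremum s' in \<open>P\<close> exists by completeness and lies in
      \<open>S\<close> by closure. It is then also the supremum in \<open>S\<close>, so it equals
      \<open>e s\<close> by uniqueness.\<close>
    then obtain s' where s': "is_sup_in P leP (e ` D) s'"
      using dcpo directed_in_subset[OF _ SP] unfolding dcpo_on_def by blast
    then have "s' \<in> S"
      using dir sub unfolding sub_dcpo_def by blast
    with s' SP have "is_sup_in S leP (e ` D) s'"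
      by (rule is_sup_in_subset)
    moreover have "is_sup_in S leP (e ` D) (e s)"
      using D g unfolding scott_continuous_def e_def by blast
    ultimately have "s' = e s"
      by (rule is_sup_in_unique[OF anti])
    then show "is_sup_in P leP (e ` D) (e s)"
      using s' by simp
  qed
  then show ?thesis
    using e_iff unfolding scott_embedding_def by blast
qed

section \<open>Embeddings and retractions\<close>

lemma embedding_imp_retract:
  fixes le :: "'a \<Rightarrow> 'a \<Rightarrow> bool"
  assumes po: "poset_on P le" and e: "scott_embedding {0..1::real} (\<le>) P le e"
  shows "scott_retract {0..1::real} (\<le>) P le"
proof -
  have trans: "transp_on P le"
    using po unfolding poset_on_def by blast
  have cont: "scott_continuous {0..1} (\<le>) P le e"
    and e_iff: "\<And>s t. s \<in> {0..1} \<Longrightarrow> t \<in> {0..1} \<Longrightarrow> le (e s) (e t) \<longleftrightarrow> s \<le> t"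
    using e unfolding scott_embedding_def by auto
  have eP: "e t \<in> P" if "t \<in> {0..1}" for t
    using that cont unfolding scott_continuous_def by blast
  \<comment> \<open>Inserting 1 makes the set nonempty, so that its real infimum lies in [0,1] and
    is 1 when no \<open>e t\<close> lies above x.\<close>
  define U where "U x = insert 1 {t\<in>{0..1}. le x (e t)}" for x
  define r where "r x = Inf (U x)" for x
  have U01: "U x \<subseteq> {0..1}" and U_ne: "U x \<noteq> {}" for x
    by (auto simp: U_def)
  have bdd: "bdd_below (U x)" for x
    using U01[of x] by (intro bdd_belowI[where m = 0]) auto
  have r01: "r x \<in> {0..1}" for x
  proof -
    have "0 \<le> r x"
      unfolding r_def using U01[of x] by (intro cInf_greatest U_ne) auto
    moreover have "r x \<le> 1"
      unfolding r_def by (intro cInf_lower bdd) (simp add: U_def)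
    ultimately show ?thesis
      by simp
  qed
  have r_le: "r x \<le> t" if "t \<in> {0..1}" "le x (e t)" for x t
    unfolding r_def using that by (intro cInf_lower bdd) (simp add: U_def)
  \<comment> \<open>The strict inequality matters: \<open>e\<close> preserves directed suprema but
    perhaps not infima, so x need not lie below \<open>e (r x)\<close>. This is why the arguments
    below insert a real t strictly between two values.\<close>
  have le_e: "le x (e t)" if xt: "x \<in> P" "t \<in> {0..1}" "r x < t" for x t
  proof -
    obtain u where u: "u \<in> U x" "u < t"
      using xt(3) cInf_lessD[OF U_ne] unfolding r_def by blast
    \<comment> \<open>Since u < t and t is at most 1, u is not the inserted default 1, so x really
      lies below \<open>e u\<close>.\<close>
    then have "u \<in> {0..1}" "le x (e u)"
      using xt(2) by (auto simp: U_def)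
    moreover from this have "le (e u) (e t)"
      using xt(2) u(2) e_iff by auto
    ultimately show ?thesis
      using xt(1,2) eP trans by (meson transp_onD)
  qed
  have r_mono: "r x \<le> r y" if "x \<in> P" "y \<in> P" "le x y" for x y
  proof (rule ccontr)
    assume "\<not> r x \<le> r y"
    then have "r y < r x"
      by simp
    then obtain t where t: "r y < t" "t < r x"
      using dense by blast
    then have t01: "t \<in> {0..1}"
      using r01[of x] r01[of y] by auto
    then have "le x (e t)"
      using that le_e[OF that(2) t01 t(1)] eP trans by (meson transp_onD)
    then show False
      using r_le[OF t01] t(2) by force
  qed
  have "scott_continuous P le {0..1} (\<le>) r"
    unfolding scott_continuous_def
  proof (intro conjI allI impI)
    show "r ` P \<subseteq> {0..1}"
      using r01 by blast
    show "monotone_on P le (\<le>) r"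
      using r_mono by (simp add: monotone_on_def)
    fix D s assume D: "directed_in P le D \<and> is_sup_in P le D s"
    then have DP: "D \<subseteq> P" and s: "s \<in> P"
      unfolding directed_in_def is_sup_in_def by auto
    show "is_sup_in {0..1} (\<le>) (r ` D) (r s)"
      unfolding is_sup_in_def
    proof (intro conjI ballI impI r01)
      show "x \<le> r s" if "x \<in> r ` D" for x
        using that D DP s r_mono unfolding is_sup_in_def by blast
      show "r s \<le> u" if u: "u \<in> {0..1}" "\<forall>x\<in>r ` D. x \<le> u" for u
      proof (rule ccontr)
        assume "\<not> r s \<le> u"
        then have "u < r s"
          by simp
        then obtain t where t: "u < t" "t < r s"
          using dense by blast
        then have t01: "t \<in> {0..1}"
          using r01[of s] u(1) by auto
        \<comment> \<open>Every x in \<open>D\<close> has \<open>r x\<close> at most u, hence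
          strictly below t, so \<open>e t\<close> is an upper bound of \<open>D\<close>. The
          supremum s is then below \<open>e t\<close>, which forces \<open>r s\<close> to be at most
          t.\<close>
        have "le x (e t)" if "x \<in> D" for x
          using that DP t(1) u(2) t01 by (intro le_e) force+
        then have "le s (e t)"
          using D eP[OF t01] unfolding is_sup_in_def by blast
        then show False
          using r_le[OF t01] t(2) by force
      qed
    qed
  qed
  moreover have "r (e t) = t" if t: "t \<in> {0..1}" for t
  proof (rule antisym)
    show "r (e t) \<le> t"
      using t e_iff by (intro r_le) auto
    \<comment> \<open>Each member of \<open>U (e t)\<close> is either 1 or some u with
      \<open>e t\<close> below \<open>e u\<close>; order reflection turns the latter into t \<le>
      u.\<close>
    show "t \<le> r (e t)"
      unfolding r_def using t e_iff by (intro cInf_greatest U_ne) (auto simp: U_def)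
  qed
  ultimately show ?thesis
    using cont unfolding scott_retract_def by blast
qed

text \<open>A section of a monotone map reflects the order: applying \<open>r\<close> to
  \<open>leP (e s) (e t)\<close> returns \<open>leQ s t\<close>.\<close>

lemma retract_imp_embedding:
  assumes "scott_retract Q leQ P leP"
  shows "\<exists>e. scott_embedding Q leQ P leP e"
proof -
  obtain r e where r: "scott_continuous P leP Q leQ r" and e: "scott_continuous Q leQ P leP e"
    and re: "\<And>t. t \<in> Q \<Longrightarrow> r (e t) = t"
    using assms unfolding scott_retract_def by blast
  have "leP (e s) (e t) \<longleftrightarrow> leQ s t" if "s \<in> Q" "t \<in> Q" for s t
    using that r e re unfolding scott_continuous_def
    by (metis image_subset_iff monotone_onD)
  then show ?thesis
    using e unfolding scott_embedding_def by blast
qed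

section \<open>A chain of rationals inside an embedded interval\<close>

lemma embedding_imp_rat_chain:
  fixes le :: "'a \<Rightarrow> 'a \<Rightarrow> bool"
  assumes e: "scott_embedding {0..1::real} (\<le>) P le e"
  shows "\<exists>C\<subseteq>P. Complete_Partial_Order.chain le C \<and>
           order_isomorphic C le (UNIV :: rat set) (\<le>)"
proof -
  \<comment> \<open>The logistic function is strictly increasing with values strictly between 0 and
    1, so it places an order-isomorphic copy of the rationals inside [0,1], on which
    \<open>e\<close> can be evaluated.\<close>
  define h :: "rat \<Rightarrow> real" where "h x = 1 / (1 + exp (- of_rat x))" for x
  have h01: "h x \<in> {0..1}" for x
    by (simp add: h_def add_pos_pos divide_le_eq)
  have h_iff: "h x \<le> h y \<longleftrightarrow> x \<le> y" for x y
    by (simp add: h_def add_pos_pos field_simps of_rat_less_eq)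
  define q where "q = e \<circ> h"
  have q: "le (q x) (q y) \<longleftrightarrow> x \<le> y" for x y
    using e h01 h_iff unfolding scott_embedding_def q_def by simp
  have "inj q"
    by (rule injI) (metis q order.antisym order.refl)
  then have bij: "bij_betw (inv q) (range q) UNIV"
    by (simp add: bij_betw_inv_into inj_on_imp_bij_betw)
  have "range q \<subseteq> P"
    using e h01 unfolding scott_embedding_def scott_continuous_def q_def by auto
  \<comment> \<open>Comparability in the range is linearity of the rational order, transported along
    \<open>q\<close>.\<close>
  moreover have "Complete_Partial_Order.chain le (range q)"
    by (auto simp: Complete_Partial_Order.chain_def q)
  moreover have "order_isomorphic (range q) le (UNIV :: rat set) (\<le>)"
    unfolding order_isomorphic_def
  proof (intro exI conjI ballI)
    fix x y assume "x \<in> range q" "y \<in> range q"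
    then show "le x y \<longleftrightarrow> inv q x \<le> inv q y"
      using q \<open>inj q\<close> by auto
  qed (rule bij)
  ultimately show ?thesis
    by blast
qed

theorem proposition4p3:
  fixes P :: "'a set" and le :: "'a \<Rightarrow> 'a \<Rightarrow> bool"
  assumes "dcpo_on P le"
  shows "((\<exists>C\<subseteq>P. Complete_Partial_Order.chain le C \<and>
              order_isomorphic C le (UNIV :: rat set) (\<le>))
          \<longleftrightarrow> (\<exists>S. sub_dcpo S P le \<and> scott_isomorphic S le {0..1::real} (\<le>)))
       \<and> ((\<exists>S. sub_dcpo S P le \<and> scott_isomorphic S le {0..1::real} (\<le>))
          \<longleftrightarrow> scott_retract {0..1::real} (\<le>) P le)"
    (is "(?chain \<longleftrightarrow> ?sub) \<and> (_ \<longleftrightarrow> ?retract)")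
proof -
  let ?emb = "\<exists>e. scott_embedding {0..1::real} (\<le>) P le e"
  have po: "poset_on P le"
    using assms unfolding dcpo_on_def by blast
  have "?emb" if ?chain
  proof -
    obtain C and f :: "'a \<Rightarrow> rat" where C: "C \<subseteq> P" and f: "bij_betw f C UNIV"
      and f_iff: "\<And>x y. x \<in> C \<Longrightarrow> y \<in> C \<Longrightarrow> le x y \<longleftrightarrow> f x \<le> f y"
      using \<open>?chain\<close> unfolding order_isomorphic_def by blast
    \<comment> \<open>The isomorphism is given from the chain onto the rationals; its inverse
      enumerates the chain by rationals, the form from which the cuts are built.\<close>
    have q: "inv_into C f x \<in> C" "f (inv_into C f x) = x" for x
      using f by (auto simp: bij_betw_def inv_into_into f_inv_into_f)
    show ?emb
    proof (rule rat_chain_imp_embedding[OF assms])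
      show "range (inv_into C f) \<subseteq> P"
        using q(1) C by blast
      show "le (inv_into C f x) (inv_into C f y) \<longleftrightarrow> x \<le> y" for x y
        using f_iff q by simp
    qed
  qed
  moreover have ?chain if ?emb
    using that embedding_imp_rat_chain by blast
  moreover have ?emb if ?sub
    using that sub_dcpo_imp_embedding[OF assms] by blast
  moreover have ?sub if ?emb
    using that embedding_imp_sub_dcpo[OF po] by blast
  moreover have ?emb if ?retract
    using that by (rule retract_imp_embedding)
  moreover have ?retract if ?emb
    using that embedding_imp_retract[OF po] by blast
  \<comment> \<open>Each of the three conditions has been shown equivalent to \<open>?emb\<close>;
    what remains is propositional.\<close>
  ultimately show ?thesis
    by argo
qed

end
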